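(* Let $X$ and $Y$ be Banach spaces, $U \subset X$ an open set, $f \colon U \to Y$ a (Fréchet) differentiable function in $U$, $x_0 \in U$, $R > 0$ satisfying $\bar{B}(x_0, R) \subset U$, let $(r_k)_{k \in \mathbb{N}}$ be a sequence in $X$, and let $\eta \geq 0$, $K>0$ and $d>0$ be real numbers. Suppose that (a) $Df(x_0)$ is invertible with $Df(x_0)^{-1} \in \mathcal{L}(Y,X)$. (b) $\| Df(x_0)^{-1}f(x_0) \| \leq \eta$ and $\| Df(x_0)^{-1}(Df(x)-Df(y)) \| \leq K \| x-y \|$ for all $x,y \in \bar{B}(x_0,R)$. (c) $\| r_k \| \leq d$ for all $k \in \mathbb{N}$. (d) The polynomial $g_d(t) = \eta_d-1_d\, t+\frac{3K}{2}t^2$, where $\eta_d = \eta+d$ and $1_d=1+Kd$, has a smallest real zero $t_d^*\leq R$ (that is, $g_d$ has a real zero and its smallest real zero $t_d^*$ satisfies $t_d^* \le R$), and moreover $d\leq \frac{1}{K}$. Then $0<t^*_d\leq \frac{1}{K}\left(1 - \frac{1}{\sqrt{3}}\right)$ and moreover: (i) The function $f$ has a unique zero $x^*$ in $\bar{B}(x_0,t_d^* )$. (ii) The sequence $(x_k)_{k\in \mathbb{N}}$ starting at $x_0$ and defined by $x_{k+1} = T_f(x_k)+r_k$ for all $k\in \mathbb{N}$ is feasible for the Newton method for $f$ in $\bar{B}(x_0,t_d^* )$. (iii) $\|x^*-x_{k+1}\|\leq \frac{\sqrt{3}}{2}K\|x^*-x_k\|^2+\|r_k\|$ for all $k\in \mathbb{N}$.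 (iv) $\lim_{k\to \infty}x_k=x^*$ in case $\lim_{k\to \infty}\|r_k\|=0$.
   Context: $\mathbb{N}$ includes $0$. $\mathcal{L}(X,Y)$ is the Banach space of bounded linear operators from $X$ to $Y$ with the operator norm $\|G\| = \sup_{\|x\|_X\leq 1}\|G(x)\|_Y$. $\bar{B}(x_0,r)$ is the closed ball in $X$ of radius $r$ centered at $x_0$. "Differentiable" means Fréchet differentiable at every point of $U$, with derivative $Df \colon U \to \mathcal{L}(X,Y)$. Newton operator: $T_f \colon X \to X$ is defined by $T_f(x) = x - Df(x)^{-1}f(x)$ if $x\in U$ and $Df(x)$ is invertible, and $T_f(x)=0$ otherwise. Feasibility: for $A\subset U$, a sequence $(x_k)_{k \in \mathbb{N}}$ in $X$ is feasible for the Newton method for $f$ in $A$ if $x_k \in A$ and $Df(x_k)$ is invertible for all $k \in \mathbb{N}$. *)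

theory Defs
  imports "HOL-Analysis.Analysis" "HOL-Computational_Algebra.Polynomial"
begin

abbreviation Df :: "('a::real_normed_vector \<Rightarrow> 'b::real_normed_vector) \<Rightarrow> 'a \<Rightarrow> 'a \<Rightarrow> 'b" where
  "Df f x \<equiv> frechet_derivative f (at x)"

(* Functions U \<rightarrow> Y are modelled as total functions; U is a parameter so that the
   values of f outside U never matter. At points of differentiability Df f x is bounded
   linear, and it is invertible iff it is bijective; between Banach spaces its inverse is
   then bounded by the open mapping theorem. *)
definition newton_op ::
  "'a::real_normed_vector set \<Rightarrow> ('a \<Rightarrow> 'b::real_normed_vector) \<Rightarrow> 'a \<Rightarrow> 'a" where
  "newton_op U f x = (if x \<in> U \<and> bij (Df f x) then x - inv (Df f x) (f x) else 0)"

definition newton_feasible ::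
  "('a::real_normed_vector \<Rightarrow> 'b::real_normed_vector) \<Rightarrow> 'a set \<Rightarrow> (nat \<Rightarrow> 'a) \<Rightarrow> bool" where
  "newton_feasible f A x \<longleftrightarrow> (\<forall>k. x k \<in> A \<and> bij (Df f (x k)))"

primrec perturbed_newton ::
  "'a::real_normed_vector set \<Rightarrow> ('a \<Rightarrow> 'b::real_normed_vector) \<Rightarrow> 'a \<Rightarrow> (nat \<Rightarrow> 'a) \<Rightarrow> nat \<Rightarrow> 'a" where
  "perturbed_newton U f x0 r 0 = x0"
| "perturbed_newton U f x0 r (Suc k) = newton_op U f (perturbed_newton U f x0 r k) + r k"

definition majorant_poly :: "real \<Rightarrow> real \<Rightarrow> real \<Rightarrow> real poly" where
  "majorant_poly \<eta> K d = [: \<eta> + d, - (1 + K * d), 3 * K / 2 :]"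

end

theory Submission
  imports Defs
begin

text \<open>
  Put \<open>A = Df f x0\<close> and \<open>F = A\<^sup>-\<^sup>1 \<circ> f\<close>. Then \<open>F\<close> maps the Banach space \<open>X\<close> to itself, has the same zeros
  and the same Newton steps as \<open>f\<close>, and its derivative is \<open>K\<close>-Lipschitz on the ball of radius \<open>t\<close>
  about \<open>x0\<close> and equals the identity at \<open>x0\<close>. Hence everything happens in the setting of the locale
  \<open>normalized_newton\<close> below, where three ideas suffice.

  The arithmetic of the majorant polynomial (\<open>majorant_root_bounds\<close>, \<open>majorant_root_balance\<close>): as
  \<open>K * d \<le> 1\<close>, the existence of a real root forces \<open>K * d \<le> 2 - sqrt 3\<close>, and its smallest root lies left of its
  vertex \<open>(1 + K * d) / (3 * K)\<close>; together these bound \<open>K * t\<close> by \<open>1 - 1 / sqrt 3\<close>. Therefore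
  \<open>DF x\<close> differs from the identity by less than \<open>1\<close> throughout the ball, so it is invertible with an
  inverse of norm at most \<open>1 / (1 - K * t) \<le> sqrt 3\<close> (\<open>near_identity_bij\<close>,
  \<open>near_identity_lower_bound\<close>).

  The zero (\<open>unique_zero\<close>) comes from Banach's fixed point theorem for \<open>\<lambda>x. x - F x\<close>, which has Lipschitz constant
  \<open>K * t < 1\<close> on the ball; it maps the ball into itself because \<open>\<eta> + K / 2 * t\<^sup>2 \<le> t\<close>.

  One estimate on a Newton step (\<open>newton_step_error\<close>) gives both feasibility and the error bound:
  the distance of the unperturbed iterate from \<open>x\<close> to any point \<open>z\<close> of the ball is at most
  \<open>(norm (F z) + K / 2 * (norm (z - x))\<^sup>2) / (1 - K * norm (x - x0))\<close>. For \<open>z = x0\<close>, the equation for \<open>t\<close>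
  says exactly that a perturbation of size at most \<open>d\<close> does not push the iterate out of the ball; for \<open>z\<close> the
  zero, one obtains the quadratic error bound. As the error never exceeds the diameter \<open>2 * t\<close>, that
  bound is also linear with factor \<open>sqrt 3 - 1 < 1\<close>, which yields convergence when the
  perturbations tend to zero (\<open>perturbed_contraction_tendsto_0\<close>).
\<close>

section \<open>Linear maps close to the identity\<close>

text \<open>
  Solving \<open>A v = y\<close> is the fixed point problem \<open>v = y - (A v - v)\<close>, whose right-hand side has
  Lipschitz constant \<open>q\<close>; this avoids the Neumann series.
\<close>

lemma near_identity_bij:
  fixes A :: "'a::banach \<Rightarrow> 'a"
  assumes "linear A" and "0 \<le> q" and "q < 1"
    and near: "\<And>v. norm (A v - v) \<le> q * norm v"
  shows "bij A"
proof -
  have "\<exists>!v. A v = y" for y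
  proof -
    have "dist (y - (A v - v)) (y - (A w - w)) \<le> q * dist v w" for v w
    proof -
      have "dist (y - (A v - v)) (y - (A w - w)) = norm (A (w - v) - (w - v))"
        by (simp add: dist_norm linear_diff[OF assms(1)] algebra_simps)
      also have "\<dots> \<le> q * dist v w"
        using near[of "w - v"] by (simp only: dist_norm norm_minus_commute[of v w])
      finally show ?thesis .
    qed
    then have "\<exists>!v. y - (A v - v) = v"
      by (intro banach_fix_type[OF assms(2,3)]) simp
    moreover have "y - (A v - v) = v \<longleftrightarrow> A v = y" for v
      by (auto simp: algebra_simps)
    ultimately show ?thesis by simp
  qed
  then show ?thesis by (metis bij_iff)
qed

lemma near_identity_lower_bound:
  fixes A :: "'a::real_normed_vector \<Rightarrow> 'a"
  assumes "norm (A v - v) \<le> q * norm v"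
  shows "(1 - q) * norm v \<le> norm (A v)"
  using assms norm_triangle_ineq2[of v "v - A v"] by (simp add: algebra_simps norm_minus_commute)

section \<open>First-order Taylor remainder\<close>

text \<open>
  A derivative that is only Lipschitz at the base point need not be integrable along a segment, so
  the remainder is compared with the real majorant \<open>K * (norm (y - x))\<^sup>2 * s\<^sup>2 / 2\<close> by the mean value
  inequality instead of being written as an integral.
\<close>

lemma taylor_remainder_lipschitz_derivative:
  fixes F :: "'a::real_normed_vector \<Rightarrow> 'b::real_normed_vector"
  assumes S: "convex S" "x \<in> S" "y \<in> S"
    and deriv: "\<And>z. z \<in> S \<Longrightarrow> (F has_derivative F' z) (at z)"
    and lip: "\<And>z v. z \<in> S \<Longrightarrow> norm (F' z v - F' x v) \<le> K * norm (z - x) * norm v"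
  shows "norm (F y - F x - F' x (y - x)) \<le> K / 2 * (norm (y - x))\<^sup>2"
proof -
  define h where "h = y - x"
  define \<phi> where "\<phi> = (\<lambda>s. F (x + s *\<^sub>R h) - s *\<^sub>R F' x h)"
  define \<psi> where "\<psi> = (\<lambda>s. K * (norm h)\<^sup>2 * s\<^sup>2 / 2)"
  have inS: "x + s *\<^sub>R h \<in> S" if "0 \<le> s" "s \<le> 1" for s
  proof -
    have "x + s *\<^sub>R h = (1 - s) *\<^sub>R x + s *\<^sub>R y"
      by (simp add: h_def algebra_simps)
    then show ?thesis using convexD_alt[OF S that] by simp
  qed
  have \<phi>': "(\<phi> has_vector_derivative (F' (x + s *\<^sub>R h) h - F' x h)) (at s)"
    if "0 \<le> s" "s \<le> 1" for s
  proof -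
    have lin: "linear (F' (x + s *\<^sub>R h))"
      using deriv[OF inS[OF that]] has_derivative_linear by blast
    have "((\<lambda>s. F (x + s *\<^sub>R h)) has_derivative (\<lambda>u. F' (x + s *\<^sub>R h) (u *\<^sub>R h))) (at s)"
      by (rule has_derivative_compose[where f = "\<lambda>s. x + s *\<^sub>R h", OF _ deriv[OF inS[OF that]]])
        (auto intro!: derivative_eq_intros)
    then have "((\<lambda>s. F (x + s *\<^sub>R h)) has_vector_derivative F' (x + s *\<^sub>R h) h) (at s)"
      by (simp add: has_vector_derivative_def linear_cmul[OF lin])
    then show ?thesis unfolding \<phi>_def
      by (auto intro!: derivative_eq_intros)
  qed
  have \<psi>': "(\<psi> has_vector_derivative (K * (norm h)\<^sup>2 * s)) (at s)" for s
    unfolding \<psi>_def has_real_derivative_iff_has_vector_derivative[symmetric]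
    by (auto intro!: derivative_eq_intros)
  have "norm (\<phi> 1 - \<phi> 0) \<le> \<psi> 1 - \<psi> 0"
  proof (rule differentiable_bound_general[OF _ _ _ \<phi>' \<psi>'])
    show "continuous_on {0..1} \<phi>"
      by (meson \<phi>' atLeastAtMost_iff continuous_at_imp_continuous_on has_vector_derivative_continuous)
    show "continuous_on {0..1} \<psi>"
      unfolding \<psi>_def by (intro continuous_intros) auto
    show "norm (F' (x + s *\<^sub>R h) h - F' x h) \<le> K * (norm h)\<^sup>2 * s" if "0 < s" "s < 1" for s
      using lip[OF inS, of s h] that by (simp add: power2_eq_square algebra_simps)
  qed auto
  then show ?thesis
    by (simp add: \<phi>_def \<psi>_def h_def algebra_simps)
qed

section \<open>The majorant polynomial\<close>

lemma poly_majorant_poly: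
  "poly (majorant_poly \<eta> K d) s = \<eta> + d - (1 + K * d) * s + 3 * K / 2 * s\<^sup>2"
  by (simp add: majorant_poly_def power2_eq_square algebra_simps)

text \<open>
  The equation \<open>g t = 0\<close> in the form in which it is used: its right-hand side is the bound for a perturbed
  Newton iterate started on the sphere of radius \<open>t\<close>, multiplied by \<open>1 - K * t\<close>.
\<close>

lemma majorant_root_balance:
  assumes "poly (majorant_poly \<eta> K d) t = 0"
  shows "t * (1 - K * t) = \<eta> + K / 2 * t\<^sup>2 + d * (1 - K * t)"
  using assms by (simp add: poly_majorant_poly power2_eq_square algebra_simps)

lemma majorant_root_bounds:
  assumes "\<eta> \<ge> 0" "K > 0" "d > 0" "d \<le> 1 / K"
    and root: "poly (majorant_poly \<eta> K d) t = 0"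
    and least: "\<And>s. poly (majorant_poly \<eta> K d) s = 0 \<Longrightarrow> t \<le> s"
  shows "0 < t" and "K * t \<le> 1 - 1 / sqrt 3"
proof -
  define a where "a = K * d"
  have a: "0 < a" "a \<le> 1"
    using assms by (auto simp: a_def field_simps)
  have g: "\<eta> + d - (1 + a) * t + 3 * K / 2 * t\<^sup>2 = 0"
    using root by (simp add: poly_majorant_poly a_def)
  show "0 < t"
  proof (rule ccontr)
    assume "\<not> 0 < t"
    then have "(1 + a) * t \<le> 0" using a by (simp add: mult_le_0_iff)
    moreover have "0 \<le> 3 * K / 2 * t\<^sup>2" using assms by simp
    ultimately show False using g assms by linarith
  qed
  \<comment> \<open>The reflection of a root at the vertex is again a root, so the smallest root is at most the
    vertex.\<close>
  define s where "s = 2 * (1 + a) / (3 * K) - t"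
  have s: "3 * K * (s + t) = 2 * (1 + a)"
    using assms by (simp add: s_def)
  have "(1 + a) * s - 3 * K / 2 * s\<^sup>2 = 3 * K * (s + t) / 2 * s - 3 * K / 2 * s\<^sup>2"
    unfolding s by simp
  also have "\<dots> = 3 * K * (s + t) / 2 * t - 3 * K / 2 * t\<^sup>2"
    by (simp add: power2_eq_square algebra_simps)
  also have "\<dots> = (1 + a) * t - 3 * K / 2 * t\<^sup>2"
    unfolding s by simp
  finally have "poly (majorant_poly \<eta> K d) s = 0"
    using g by (simp add: poly_majorant_poly a_def)
  then have "t \<le> s" by (rule least)
  then have "3 * K * t \<le> 3 * K * s"
    using \<open>K > 0\<close> by simp
  then have vertex: "3 * (K * t) \<le> 1 + a"
    using s by (simp add: algebra_simps)
  \<comment> \<open>Completing the square, \<open>(3 * K * t - (1 + a))\<^sup>2\<close> is the discriminant, and it is at most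
    \<open>a\<^sup>2 - 4 * a + 1 = (2 - a)\<^sup>2 - 3\<close>.\<close>
  have "(3 * (K * t) - (1 + a))\<^sup>2 = (1 + a)\<^sup>2 - 6 * K * \<eta> - 6 * a
          + 6 * K * (\<eta> + d - (1 + a) * t + 3 * K / 2 * t\<^sup>2)"
    by (simp add: a_def power2_eq_square algebra_simps)
  then have "(3 * (K * t) - (1 + a))\<^sup>2 = (1 + a)\<^sup>2 - 6 * K * \<eta> - 6 * a"
    using g by simp
  moreover have "0 \<le> 6 * K * \<eta>" using assms by simp
  ultimately have "6 * a \<le> (1 + a)\<^sup>2"
    using zero_le_power2[of "3 * (K * t) - (1 + a)"] by linarith
  then have "3 \<le> (2 - a)\<^sup>2"
    by (simp add: power2_eq_square algebra_simps)
  then have "sqrt 3 \<le> 2 - a"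
    using a by (simp add: real_le_rsqrt real_le_lsqrt)
  then have "3 * (K * t) \<le> 3 - sqrt 3" using vertex by linarith
  moreover have "3 / sqrt 3 = sqrt (3::real)"
    by (simp add: real_div_sqrt)
  ultimately show "K * t \<le> 1 - 1 / sqrt 3" by simp
qed

section \<open>Newton steps of a normalized map\<close>

locale normalized_newton =
  fixes F :: "'a::banach \<Rightarrow> 'a" and F' :: "'a \<Rightarrow> 'a \<Rightarrow> 'a" and x0 :: 'a and K t :: real
  assumes K_nonneg: "0 \<le> K" and t_nonneg: "0 \<le> t" and Kt_less: "K * t < 1"
    and deriv: "x \<in> cball x0 t \<Longrightarrow> (F has_derivative F' x) (at x)"
    and lip: "x \<in> cball x0 t \<Longrightarrow> y \<in> cball x0 t \<Longrightarrow>
      norm (F' x v - F' y v) \<le> K * norm (x - y) * norm v"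
    and deriv_center: "F' x0 v = v"
begin

lemma center_mem: "x0 \<in> cball x0 t"
  using t_nonneg by simp

lemma deriv_near_identity:
  assumes "x \<in> cball x0 t"
  shows "norm (F' x v - v) \<le> K * norm (x - x0) * norm v"
  using lip[OF assms center_mem, of v] by (simp add: deriv_center)

lemma K_dist_le:
  assumes "x \<in> cball x0 t"
  shows "K * norm (x - x0) \<le> K * t"
  using assms K_nonneg by (auto simp: dist_norm norm_minus_commute intro: mult_left_mono)

lemma deriv_bij:
  assumes "x \<in> cball x0 t"
  shows "bij (F' x)"
proof (rule near_identity_bij[OF _ _ _ deriv_near_identity[OF assms]])
  show "linear (F' x)" using deriv[OF assms] has_derivative_linear by blast
  show "0 \<le> K * norm (x - x0)" using K_nonneg by simp
  show "K * norm (x - x0) < 1" using K_dist_le[OF assms] Kt_less by linarith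
qed

lemma taylor_remainder:
  assumes "x \<in> cball x0 t" "z \<in> cball x0 t"
  shows "norm (F z - F x - F' x (z - x)) \<le> K / 2 * (norm (z - x))\<^sup>2"
  by (rule taylor_remainder_lipschitz_derivative[OF convex_cball assms])
    (use deriv lip assms in auto)

text \<open>
  Write \<open>w\<close> for the Newton correction at \<open>x\<close>. By linearity \<open>F' x\<close> sends \<open>x - w - z\<close> to
  \<open>- (F x + F' x (z - x))\<close>, which is the Taylor remainder minus \<open>F z\<close>, and \<open>F' x\<close> is bounded below.
\<close>

lemma newton_step_error:
  assumes x: "x \<in> cball x0 t" and z: "z \<in> cball x0 t" and w: "F' x w = F x"
  shows "(1 - K * norm (x - x0)) * norm (x - w - z) \<le> norm (F z) + K / 2 * (norm (z - x))\<^sup>2"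
proof -
  have lin: "linear (F' x)" using deriv[OF x] has_derivative_linear by blast
  have "F' x (x - w - z) = (F z - F x - F' x (z - x)) - F z"
    by (simp add: linear_diff[OF lin] w)
  then have "norm (F' x (x - w - z)) \<le> norm (F z) + K / 2 * (norm (z - x))\<^sup>2"
    using norm_triangle_ineq4[of "F z - F x - F' x (z - x)" "F z"] taylor_remainder[OF x z]
    by simp
  then show ?thesis
    using near_identity_lower_bound[of "F' x", OF deriv_near_identity[OF x, of "x - w - z"]]
    by linarith
qed

lemma newton_step_error_uniform:
  assumes x: "x \<in> cball x0 t" and z: "z \<in> cball x0 t" and w: "F' x w = F x"
  shows "(1 - K * t) * norm (x - w - z) \<le> norm (F z) + K / 2 * (norm (z - x))\<^sup>2"
proof -
  have "(1 - K * t) * norm (x - w - z) \<le> (1 - K * norm (x - x0)) * norm (x - w - z)"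
    using K_dist_le[OF x] by (intro mult_right_mono) auto
  then show ?thesis using newton_step_error[OF assms] by linarith
qed

text \<open>
  The zeros of \<open>F\<close> are the fixed points of \<open>\<lambda>x. x - F x\<close>. The derivative of this map is
  \<open>\<lambda>v. v - F' x v\<close>, of norm at most \<open>K * t\<close>.
\<close>

lemma unique_zero:
  assumes self_map: "norm (F x0) + K / 2 * t\<^sup>2 \<le> t"
  shows "\<exists>!x. x \<in> cball x0 t \<and> F x = 0"
proof -
  define G where "G = (\<lambda>x. x - F x)"
  have "\<exists>!x. x \<in> cball x0 t \<and> G x = x"
  proof (rule Banach_fix[where c = "K * t"])
    show "G ` cball x0 t \<subseteq> cball x0 t"
    proof safe
      fix x assume x: "x \<in> cball x0 t"
      have "x0 - G x = (F x - F x0 - F' x0 (x - x0)) + F x0"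
        by (simp add: G_def deriv_center)
      then have "norm (x0 - G x) \<le> K / 2 * (norm (x - x0))\<^sup>2 + norm (F x0)"
        using norm_triangle_ineq[of "F x - F x0 - F' x0 (x - x0)" "F x0"]
          taylor_remainder[OF center_mem x] by simp
      also have "\<dots> \<le> K / 2 * t\<^sup>2 + norm (F x0)"
        using x K_nonneg
        by (auto simp: dist_norm norm_minus_commute intro!: mult_left_mono power_mono)
      finally show "G x \<in> cball x0 t"
        using self_map by (simp add: dist_norm)
    qed
    show "dist (G x) (G y) \<le> K * t * dist x y"
      if "x \<in> cball x0 t" "y \<in> cball x0 t" for x y
      unfolding dist_norm
    proof (rule differentiable_bound[OF convex_cball _ _ that])
      fix z assume z: "z \<in> cball x0 t"
      show "(G has_derivative (\<lambda>v. v - F' z v)) (at z within cball x0 t)"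
        unfolding G_def
        by (intro has_derivative_diff has_derivative_ident
            has_derivative_at_withinI[OF deriv[OF z]])
      show "onorm (\<lambda>v. v - F' z v) \<le> K * t"
      proof (rule onorm_bound)
        fix v
        have "norm (F' z v - v) \<le> K * norm (z - x0) * norm v"
          by (rule deriv_near_identity[OF z])
        also have "\<dots> \<le> K * t * norm v"
          by (intro mult_right_mono K_dist_le[OF z]) simp
        finally show "norm (v - F' z v) \<le> K * t * norm v"
          by (simp add: norm_minus_commute)
      qed (use K_nonneg t_nonneg in simp)
    qed
  qed (use K_nonneg t_nonneg Kt_less in \<open>auto simp: complete_eq_closed\<close>)
  then show ?thesis by (simp add: G_def)
qed

end

section \<open>Perturbed linear contraction of errors\<close>

text \<open>
  Once the perturbations stay below \<open>(1 - q) * \<epsilon>\<close>, the excess of the error over \<open>\<epsilon>\<close> is multiplied by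
  at most \<open>q\<close> in each step.
\<close>

lemma perturbed_contraction_tendsto_0:
  fixes e \<rho> :: "nat \<Rightarrow> real"
  assumes e: "\<And>k. 0 \<le> e k" and q: "0 \<le> q" "q < 1"
    and step: "\<And>k. e (Suc k) \<le> q * e k + \<rho> k"
    and \<rho>: "\<rho> \<longlonglongrightarrow> 0"
  shows "e \<longlonglongrightarrow> 0"
proof (rule LIMSEQ_I)
  fix \<epsilon>' :: real assume "0 < \<epsilon>'"
  define \<epsilon> where "\<epsilon> = \<epsilon>' / 2"
  have \<epsilon>: "0 < \<epsilon>" using \<open>0 < \<epsilon>'\<close> by (simp add: \<epsilon>_def)
  have "eventually (\<lambda>k. \<rho> k < (1 - q) * \<epsilon>) sequentially"
    using order_tendstoD(2)[OF \<rho>, of "(1 - q) * \<epsilon>"] q \<epsilon> by simp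
  then obtain N where N: "\<And>k. k \<ge> N \<Longrightarrow> \<rho> k < (1 - q) * \<epsilon>"
    by (auto simp: eventually_sequentially)
  have decay: "e (N + m) \<le> q ^ m * e N + \<epsilon>" for m
  proof (induction m)
    case 0
    then show ?case using \<epsilon> by simp
  next
    case (Suc m)
    have "e (N + Suc m) \<le> q * e (N + m) + \<rho> (N + m)"
      using step[of "N + m"] by simp
    also have "\<dots> \<le> q * (q ^ m * e N + \<epsilon>) + (1 - q) * \<epsilon>"
      using Suc.IH N[of "N + m"] q by (intro add_mono mult_left_mono) auto
    finally show ?case by (simp add: algebra_simps)
  qed
  have "(\<lambda>m. q ^ m * e N) \<longlonglongrightarrow> 0"
    using LIMSEQ_power_zero[of q] q by (intro tendsto_mult_left_zero) auto
  from order_tendstoD(2)[OF this \<epsilon>] obtain M where M: "\<And>m. m \<ge> M \<Longrightarrow> q ^ m * e N < \<epsilon>"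
    by (auto simp: eventually_sequentially)
  have "norm (e k - 0) < \<epsilon>'" if "k \<ge> N + M" for k
  proof -
    have "N + (k - N) = k" "k - N \<ge> M" using that by auto
    then have "e k < \<epsilon> + \<epsilon>" using decay[of "k - N"] M[of "k - N"] by simp
    then show ?thesis using e[of k] by (simp add: \<epsilon>_def)
  qed
  then show "\<exists>no. \<forall>k\<ge>no. norm (e k - 0) < \<epsilon>'" by blast
qed

section \<open>Robustness of Newton's method\<close>

theorem theorem2:
  fixes f :: "'a::banach \<Rightarrow> 'b::banach"
    and U :: "'a set" and x0 :: 'a and r :: "nat \<Rightarrow> 'a"
    and R \<eta> K d t :: real
  assumes "open U"
    and "f differentiable_on U"
    and "x0 \<in> U" and "R > 0" and "cball x0 R \<subseteq> U"
    and "\<eta> \<ge> 0" and "K > 0" and "d > 0"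
    and a: "bij (Df f x0)" "bounded_linear (inv (Df f x0))"
    and b: "norm (inv (Df f x0) (f x0)) \<le> \<eta>"
      "\<And>x y. x \<in> cball x0 R \<Longrightarrow> y \<in> cball x0 R \<Longrightarrow>
         onorm (inv (Df f x0) \<circ> (\<lambda>v. Df f x v - Df f y v)) \<le> K * norm (x - y)"
    and c: "\<And>k. norm (r k) \<le> d"
    and d: "poly (majorant_poly \<eta> K d) t = 0"
      "\<And>s. poly (majorant_poly \<eta> K d) s = 0 \<Longrightarrow> t \<le> s"
      "t \<le> R" "d \<le> 1 / K"
  shows "0 < t \<and> t \<le> 1 / K * (1 - 1 / sqrt 3) \<and>
    (\<exists>xs. xs \<in> cball x0 t \<and> f xs = 0 \<and>
      (\<forall>z \<in> cball x0 t. f z = 0 \<longrightarrow> z = xs) \<and>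
      newton_feasible f (cball x0 t) (perturbed_newton U f x0 r) \<and>
      (\<forall>k. norm (xs - perturbed_newton U f x0 r (Suc k))
            \<le> sqrt 3 / 2 * K * (norm (xs - perturbed_newton U f x0 r k))\<^sup>2 + norm (r k)) \<and>
      ((\<lambda>k. norm (r k)) \<longlonglongrightarrow> 0 \<longrightarrow> perturbed_newton U f x0 r \<longlonglongrightarrow> xs))"
proof -
  define A where "A = inv (Df f x0)"
  define F where "F = A \<circ> f"
  define F' where "F' = (\<lambda>x. A \<circ> Df f x)"
  define x where "x = perturbed_newton U f x0 r"
  note root = majorant_root_bounds[OF \<open>\<eta> \<ge> 0\<close> \<open>K > 0\<close> \<open>d > 0\<close> d(4,1,2)]
  note bal = majorant_root_balance[OF d(1)]
  have t: "0 < t" and Kt: "K * t \<le> 1 - 1 / sqrt 3" using root by auto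
  have Kt1: "K * t < 1" using Kt by (smt (verit) divide_pos_pos real_sqrt_gt_0_iff)
  have ball: "cball x0 t \<subseteq> cball x0 R" using d(3) by auto
  then have ballU: "cball x0 t \<subseteq> U" using \<open>cball x0 R \<subseteq> U\<close> by blast
  have A: "bounded_linear A" and bijA: "bij A"
    using a by (auto simp: A_def bij_imp_bij_inv)
  have A0: "A v = 0 \<longleftrightarrow> v = 0" for v
    using inj_eq[OF bij_is_inj[OF bijA], of v 0] linear_simps(3)[OF A] by simp
  have df: "(f has_derivative Df f y) (at y)" if "y \<in> U" for y
    using that assms(1,2) by (metis differentiable_on_def at_within_open frechet_derivative_works)
  interpret normalized_newton F F' x0 K t
  proof
    show "(F has_derivative F' y) (at y)" if "y \<in> cball x0 t" for y
      unfolding F_def F'_def comp_def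
      using bounded_linear.has_derivative[OF A df] that ballU by blast
    show "norm (F' y v - F' z v) \<le> K * norm (y - z) * norm v"
      if "y \<in> cball x0 t" "z \<in> cball x0 t" for y z v
    proof -
      let ?D = "A \<circ> (\<lambda>v. Df f y v - Df f z v)"
      have bl: "bounded_linear ?D"
        unfolding comp_def using that ballU
        by (intro bounded_linear_compose[OF A] bounded_linear_sub
            has_derivative_bounded_linear[OF df]) auto
      have "norm (?D v) \<le> onorm ?D * norm v" by (rule onorm[OF bl])
      also have "\<dots> \<le> K * norm (y - z) * norm v"
        unfolding A_def using that ball by (intro mult_right_mono b(2)) auto
      finally show ?thesis
        by (simp add: F'_def linear_simps(2)[OF A])
    qed
    show "F' x0 v = v" for v
      using a(1) by (simp add: F'_def A_def bij_is_inj)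
  qed (use t Kt1 \<open>K > 0\<close> in auto)
  have bijD: "bij (Df f y)" if "y \<in> cball x0 t" for y
  proof -
    have "Df f y = Df f x0 \<circ> F' y"
      using a(1) by (simp add: F'_def A_def fun_eq_iff bij_is_surj surj_f_inv_f)
    then show ?thesis using deriv_bij[OF that] a(1) by (simp add: bij_comp)
  qed
  have step: "\<exists>w. F' (x k) w = F (x k) \<and> x (Suc k) = x k - w + r k" if "x k \<in> cball x0 t" for k
  proof -
    have "Df f (x k) (inv (Df f (x k)) (f (x k))) = f (x k)"
      using bijD[OF that] by (simp add: bij_is_surj surj_f_inv_f)
    moreover have "newton_op U f (x k) = x k - inv (Df f (x k)) (f (x k))"
      using bijD[OF that] that ballU by (auto simp: newton_op_def)
    ultimately show ?thesis
      by (intro exI[of _ "inv (Df f (x k)) (f (x k))"]) (simp add: x_def F_def F'_def)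
  qed
  have F0: "norm (F x0) \<le> \<eta>" using b(1) by (simp add: F_def A_def)
  \<comment> \<open>The equation for \<open>t\<close> makes \<open>t - (\<eta> + K / 2 * t\<^sup>2)\<close> equal to \<open>d * (1 - K * t) + K * t\<^sup>2\<close>.\<close>
  have "norm (F x0) + K / 2 * t\<^sup>2 \<le> t"
  proof -
    have "0 \<le> d * (1 - K * t) + K * t\<^sup>2" using \<open>d > 0\<close> \<open>K > 0\<close> Kt1 by simp
    then show ?thesis using bal F0 by (simp add: power2_eq_square algebra_simps)
  qed
  from unique_zero[OF this] obtain xs where xs: "xs \<in> cball x0 t" "F xs = 0"
    and uniq: "\<And>z. z \<in> cball x0 t \<Longrightarrow> F z = 0 \<Longrightarrow> z = xs" by blast
  have mem: "x k \<in> cball x0 t" for k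
  proof (induction k)
    case 0
    then show ?case using t by (simp add: x_def)
  next
    case (Suc k)
    obtain w where w: "F' (x k) w = F (x k)" "x (Suc k) = x k - w + r k"
      using step[OF Suc] by blast
    have "(1 - K * t) * norm (x k - w - x0) \<le> norm (F x0) + K / 2 * (norm (x0 - x k))\<^sup>2"
      by (rule newton_step_error_uniform[OF Suc center_mem w(1)])
    also have "\<dots> \<le> \<eta> + K / 2 * t\<^sup>2"
      using F0 Suc \<open>K > 0\<close> by (intro add_mono mult_left_mono power_mono) (auto simp: dist_norm)
    also have "\<dots> = (1 - K * t) * (t - d)"
      using bal by (simp add: algebra_simps)
    finally have "norm (x k - w - x0) \<le> t - d"
      using Kt1 by simp
    moreover have "norm (x (Suc k) - x0) \<le> norm (x k - w - x0) + norm (r k)"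
      using norm_triangle_ineq[of "x k - w - x0" "r k"] by (simp add: w(2) algebra_simps)
    ultimately show ?case
      using c[of k] by (simp add: dist_norm norm_minus_commute)
  qed
  have err: "norm (xs - x (Suc k)) \<le> sqrt 3 / 2 * K * (norm (xs - x k))\<^sup>2 + norm (r k)" for k
  proof -
    obtain w where w: "F' (x k) w = F (x k)" "x (Suc k) = x k - w + r k"
      using step[OF mem] by blast
    have "1 / sqrt 3 * norm (x k - w - xs) \<le> (1 - K * t) * norm (x k - w - xs)"
      using Kt by (intro mult_right_mono) auto
    also have "\<dots> \<le> K / 2 * (norm (xs - x k))\<^sup>2"
      using newton_step_error_uniform[OF mem xs(1) w(1)] xs(2) by simp
    finally have "sqrt 3 * (1 / sqrt 3 * norm (x k - w - xs))
        \<le> sqrt 3 * (K / 2 * (norm (xs - x k))\<^sup>2)"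
      by (rule mult_left_mono) simp
    then have "norm (x k - w - xs) \<le> sqrt 3 / 2 * K * (norm (xs - x k))\<^sup>2"
      by simp
    moreover have "norm (xs - x (Suc k)) \<le> norm (x k - w - xs) + norm (r k)"
    proof -
      have "xs - x (Suc k) = - ((x k - w - xs) + r k)"
        by (simp add: w(2))
      then show ?thesis
        using norm_triangle_ineq[of "x k - w - xs" "r k"] by (simp only: norm_minus_cancel)
    qed
    ultimately show ?thesis by linarith
  qed
  have lim: "x \<longlonglongrightarrow> xs" if "(\<lambda>k. norm (r k)) \<longlonglongrightarrow> 0"
  proof -
    have "(\<lambda>k. norm (xs - x k)) \<longlonglongrightarrow> 0"
    proof (rule perturbed_contraction_tendsto_0[OF _ _ _ _ that])
      show "0 \<le> sqrt 3 - (1::real)" "sqrt 3 - 1 < (1::real)"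
        by (simp_all add: real_less_lsqrt)
      fix k
      \<comment> \<open>The diameter of the ball turns the quadratic error bound into a linear one.\<close>
      have "norm (xs - x k) \<le> 2 * t"
        using mem[of k] xs(1) dist_triangle2[of xs "x k" x0]
        by (simp add: dist_commute flip: dist_norm)
      then have "sqrt 3 / 2 * K * norm (xs - x k) \<le> sqrt 3 / 2 * K * (2 * t)"
        using \<open>K > 0\<close> by (intro mult_left_mono) auto
      also have "\<dots> = sqrt 3 * (K * t)" by simp
      also have "\<dots> \<le> sqrt 3 * (1 - 1 / sqrt 3)"
        using Kt by (intro mult_left_mono) auto
      also have "\<dots> = sqrt 3 - 1" by (simp add: algebra_simps)
      finally have "sqrt 3 / 2 * K * norm (xs - x k) * norm (xs - x k)
          \<le> (sqrt 3 - 1) * norm (xs - x k)"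
        by (rule mult_right_mono) simp
      then show "norm (xs - x (Suc k)) \<le> (sqrt 3 - 1) * norm (xs - x k) + norm (r k)"
        using err[of k] by (simp add: power2_eq_square mult.assoc)
    qed (rule norm_ge_zero)
    then have "(\<lambda>k. dist (x k) xs) \<longlonglongrightarrow> 0"
      by (simp only: dist_norm norm_minus_commute[of xs])
    then show ?thesis by (subst tendsto_dist_iff)
  qed
  have zero: "f z = 0 \<longleftrightarrow> F z = 0" for z by (simp add: F_def A0)
  have "t \<le> 1 / K * (1 - 1 / sqrt 3)"
    using mult_left_mono[OF Kt, of "1 / K"] \<open>K > 0\<close> by simp
  moreover have "newton_feasible f (cball x0 t) x"
    using mem bijD by (simp add: newton_feasible_def)
  ultimately show ?thesis
    unfolding x_def[symmetric]
  proof (intro conjI exI[of _ xs] ballI allI impI)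
    show "z = xs" if "z \<in> cball x0 t" "f z = 0" for z
      using uniq that zero by blast
  qed (use t xs err lim zero in blast)+
qed

end
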